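(* Let $(\mathbf Y_i)_{i\in\mathbb N}$ be a $p$-dimensional stationary time series on a probability space on which, for each $m\in\mathbb N$, $\mathbf W_{1,m},\mathbf W_{2,m}$ are independent $p$-dimensional standard Brownian motions, such that the long-run covariance matrix $\Sigma=\mathrm{Cov}(\mathbf Y_1,\mathbf Y_1)+\sum_{i\ge2}\{\mathrm{Cov}(\mathbf Y_1,\mathbf Y_i)+\mathrm{Cov}(\mathbf Y_i,\mathbf Y_1)\}$ exists and is positive definite, and for some $0<\xi<\frac12$, $$\sup_{k>m}\frac{1}{(k-m)^\xi}\Big\|\sum_{i=m+1}^k\{\mathbf Y_i-\mathbb E(\mathbf Y_1)\}-\Sigma^{1/2}\mathbf W_{1,m}(k-m)\Big\|_2=O_{\mathbb P}(1),\quad\frac{1}{m^\xi}\Big\|\sum_{i=1}^m\{\mathbf Y_i-\mathbb E(\mathbf Y_1)\}-\Sigma^{1/2}\mathbf W_{2,m}(m)\Big\|_2=O_{\mathbb P}(1).$$ Let $\Sigma_m$ be invertible $p\times p$ random matrices with $\Sigma_m\to\Sigma$ in probability. For $k\ge m+1$ define $$\tilde D_m(k)=\max_{j\in\{m,\dots,k-1\}}\frac{j(k-j)}{m^{3/2}}\|\bar{\mathbf Y}_{1:j}-\bar{\mathbf Y}_{j+1:k}\|_{\Sigma^{-1}},\qquad D_m(k)=\max_{j\in\{m,\dots,k-1\}}\frac{j(k-j)}{m^{3/2}}\|\bar{\mathbf Y}_{1:j}-\bar{\mathbf Y}_{j+1:k}\|_{\Sigma_m^{-1}}.$$ Then for any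 $\eta>0$, $\sup_{k>m}(m/k)^{\frac32+\eta}|\tilde D_m(k)-D_m(k)|=o_{\mathbb P}(1)$ as $m\to\infty$.
   Context: $\bar{\mathbf Y}_{j:k}=\frac1{k-j+1}\sum_{i=j}^k\mathbf Y_i$. For $M$ positive definite, $\|\mathbf y\|_M=\sqrt{(\mathbf y^\top M\mathbf y)/p}$; $\|\cdot\|_2$ is the Euclidean norm; $\Sigma^{1/2}$ is the symmetric positive-definite square root. *)

theory Defs
  imports "HOL-Probability.Probability"
begin

section \<open>Matrix notions\<close>

definition pos_def_mat :: "real^'p^'p \<Rightarrow> bool" where
  "pos_def_mat A \<longleftrightarrow> transpose A = A \<and> (\<forall>x. x \<noteq> 0 \<longrightarrow> x \<bullet> (A *v x) > 0)"

text \<open>Symmetric positive-definite square root.\<close>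
definition mat_sqrt :: "real^'p^'p \<Rightarrow> real^'p^'p" where
  "mat_sqrt A = (THE R. pos_def_mat R \<and> R ** R = A)"

text \<open>Weighted norm: sqrt (y' M y / p).\<close>
definition wnorm :: "real^'p^'p \<Rightarrow> real^'p \<Rightarrow> real" where
  "wnorm A y = sqrt ((y \<bullet> (A *v y)) / real CARD('p))"

section \<open>Moments\<close>

definition vexp :: "'a measure \<Rightarrow> ('a \<Rightarrow> real^'p) \<Rightarrow> real^'p" where
  "vexp M X = (\<chi> a. integral\<^sup>L M (\<lambda>\<omega>. X \<omega> $ a))"

definition cov_mat :: "'a measure \<Rightarrow> ('a \<Rightarrow> real^'p) \<Rightarrow> ('a \<Rightarrow> real^'p) \<Rightarrow> real^'p^'p" where
  "cov_mat M X Z = (\<chi> a b. integral\<^sup>L M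
      (\<lambda>\<omega>. (X \<omega> $ a - vexp M X $ a) * (Z \<omega> $ b - vexp M Z $ b)))"

section \<open>Sample means\<close>

text \<open>bar Y_{j:k} = 1/(k-j+1) * sum_{i=j}^k Y_i\<close>
definition ybar :: "(nat \<Rightarrow> real^'p) \<Rightarrow> nat \<Rightarrow> nat \<Rightarrow> real^'p" where
  "ybar y j k = (1 / (real k - real j + 1)) *\<^sub>R (\<Sum>i=j..k. y i)"

text \<open>CUSUM-type detector max_{j=m..k-1} j(k-j)/m^{3/2} ||ybar_{1:j} - ybar_{j+1:k}||_A\<close>
definition detector :: "real^'p^'p \<Rightarrow> (nat \<Rightarrow> real^'p) \<Rightarrow> nat \<Rightarrow> nat \<Rightarrow> real" where
  "detector A y m k = Max ((\<lambda>j. real j * (real k - real j) / (real m powr (3/2))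
        * wnorm A (ybar y 1 j - ybar y (j+1) k)) ` {m..k-1})"

section \<open>Stochastic notions\<close>

text \<open>Strict stationarity of (Y_i)_{i>=1}.\<close>
definition strictly_stationary :: "'a measure \<Rightarrow> (nat \<Rightarrow> 'a \<Rightarrow> real^'p) \<Rightarrow> bool" where
  "strictly_stationary M Y \<longleftrightarrow> (\<forall>h.
     distr M (PiM UNIV (\<lambda>_. borel)) (\<lambda>\<omega> i. Y (Suc i + h) \<omega>)
   = distr M (PiM UNIV (\<lambda>_. borel)) (\<lambda>\<omega> i. Y (Suc i) \<omega>))"

text \<open>p-dimensional standard Brownian motion on [0,oo).\<close>
definition std_BM :: "'a measure \<Rightarrow> (real \<Rightarrow> 'a \<Rightarrow> real^'p) \<Rightarrow> bool" where
  "std_BM M W \<longleftrightarrow>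
     (\<forall>t. W t \<in> borel_measurable M) \<and>
     (\<forall>\<omega>\<in>space M. W 0 \<omega> = 0 \<and> continuous_on {0..} (\<lambda>t. W t \<omega>)) \<and>
     (\<forall>s t a. 0 \<le> s \<longrightarrow> s < t \<longrightarrow>
        distributed M lborel (\<lambda>\<omega>. (W t \<omega> - W s \<omega>) $ a) (normal_density 0 (sqrt (t - s)))) \<and>
     (\<forall>n (t::nat \<Rightarrow> real). 0 \<le> t 0 \<longrightarrow> (\<forall>k<n. t k < t (Suc k)) \<longrightarrow>
        prob_space.indep_vars M (\<lambda>_. borel)
          (\<lambda>(k, a) \<omega>. (W (t (Suc k)) \<omega> - W (t k) \<omega>) $ a) ({..<n} \<times> UNIV))"

text \<open>Tightness (O_P(1)) of a sequence of extended-real random quantities.\<close>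
definition bdd_in_prob :: "'a measure \<Rightarrow> (nat \<Rightarrow> 'a \<Rightarrow> ereal) \<Rightarrow> bool" where
  "bdd_in_prob M X \<longleftrightarrow> (\<forall>\<epsilon>>0. \<exists>C::real. \<exists>N. \<forall>m\<ge>N.
      measure M {\<omega>\<in>space M. X m \<omega> > ereal C} \<le> \<epsilon>)"

text \<open>o_P(1) for nonnegative extended-real random quantities.\<close>
definition small_in_prob :: "'a measure \<Rightarrow> (nat \<Rightarrow> 'a \<Rightarrow> ereal) \<Rightarrow> bool" where
  "small_in_prob M X \<longleftrightarrow> (\<forall>\<epsilon>>0.
      (\<lambda>m. measure M {\<omega>\<in>space M. X m \<omega> > ereal \<epsilon>}) \<longlonglongrightarrow> 0)"

text \<open>Convergence in probability of random matrices to a constant.\<close>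
definition conv_in_prob_mat :: "'a measure \<Rightarrow> (nat \<Rightarrow> 'a \<Rightarrow> real^'p^'p) \<Rightarrow> real^'p^'p \<Rightarrow> bool" where
  "conv_in_prob_mat M S L \<longleftrightarrow> (\<forall>\<epsilon>>0.
      (\<lambda>m. measure M {\<omega>\<in>space M. norm (S m \<omega> - L) > \<epsilon>}) \<longlonglongrightarrow> 0)"

end

theory Submission
  imports Defs
begin

(* Write S_i for the centred partial sums sum_{l=1..i} (Y_l - E Y_1). Both detectors are maxima
   of the same CUSUM terms j(k-j)/m^(3/2) |Ybar_{1:j} - Ybar_{j+1:k}|, measured in the weighted
   norms of Sigma^-1 and Sigma_m^-1, and j(k-j) (Ybar_{1:j} - Ybar_{j+1:k}) = k S_j - j S_k.
   By the resolvent identity, once Sigma_m is close to Sigma the two weighted norms differ by at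
   most 2 a p sqrt |Sigma_m - Sigma| times the Euclidean norm, where p is the dimension and a
   bounds the operator norm of Sigma^-1. If |S_i| <= K m^-eta i^(1/2+eta) for all i >= m, the
   weight (m/k)^(3/2+eta) exactly absorbs k S_j - j S_k, so the weighted difference of the
   detectors is at most 4 a p K sqrt |Sigma_m - Sigma|. The smallest such K is O_P(1): the strong
   approximations reduce it to the same quantity for the two Brownian motions, up to errors of
   order i^xi with xi < 1/2, and for a Brownian motion it is bounded in probability uniformly
   in m by dyadic chaining over blocks of length about m, using only Gaussian moment bounds for
   the increments and union bounds. Finally O_P(1) times o_P(1) is o_P(1). *)

section \<open>Perturbation of the weighted norm\<close>

lemma abs_sqrt_diff_le_sqrt_abs_diff:
  fixes x y :: real
  assumes "0 \<le> x" "0 \<le> y"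
  shows "\<bar>sqrt x - sqrt y\<bar> \<le> sqrt \<bar>x - y\<bar>"
  using assms by (smt (verit, ccfv_SIG) real_sqrt_le_iff sqrt_add_le_add_sqrt)

(* Isabelle's sqrt is odd, sqrt (-x) = - sqrt x, and v \<bullet> (S^-1 v) may be negative when S is
   merely invertible, so negative arguments have to be covered. *)
lemma abs_sqrt_diff_le: "\<bar>sqrt a - sqrt b\<bar> \<le> sqrt (2 * \<bar>a - b\<bar>)"
proof -
  have sqrt_add: "sqrt x + sqrt y \<le> sqrt (2 * (x + y))" if "0 \<le> x" "0 \<le> y" for x y :: real
  proof -
    have "(sqrt x + sqrt y)\<^sup>2 \<le> 2 * (x + y)"
      using that sum_squares_bound[of "sqrt x" "sqrt y"]
      by (simp add: power2_sum)
    then show ?thesis using real_le_rsqrt by blast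
  qed
  have mono: "sqrt \<bar>a - b\<bar> \<le> sqrt (2 * \<bar>a - b\<bar>)" by simp
  consider "0 \<le> a" "0 \<le> b" | "0 \<le> a" "b < 0" | "a < 0" "0 \<le> b" | "a < 0" "b < 0" by linarith
  then show ?thesis
  proof cases
    case 1 then show ?thesis using abs_sqrt_diff_le_sqrt_abs_diff[of a b] mono by linarith
  next
    case 2 then show ?thesis using sqrt_add[of a "-b"] by (simp add: real_sqrt_minus)
  next
    case 3 then show ?thesis using sqrt_add[of "-a" b] by (simp add: real_sqrt_minus)
  next
    case 4
    then have "\<bar>sqrt a - sqrt b\<bar> \<le> sqrt \<bar>a - b\<bar>"
      using abs_sqrt_diff_le_sqrt_abs_diff[of "-a" "-b"] by (simp add: real_sqrt_minus abs_minus_commute)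
    with mono show ?thesis by linarith
  qed
qed

lemma norm_matrix_vector_mult_le: "norm (A *v x) \<le> onorm ((*v) A) * norm x"
  for A :: "real^'n^'m"
  using onorm[OF matrix_vector_mul_bounded_linear] .

lemma onorm_matrix_nonneg: "0 \<le> onorm ((*v) A)"
  for A :: "real^'n^'m"
  by (rule onorm_pos_le[OF matrix_vector_mul_bounded_linear])

lemma onorm_matrix_le_norm: "onorm ((*v) A) \<le> real CARD('m) * real CARD('n) * norm A"
  for A :: "real^'n^'m"
  by (rule onorm_le_matrix_component)
    (meson component_le_norm_cart Finite_Cartesian_Product.norm_nth_le order_trans)

lemma matrix_inv_right: "invertible A \<Longrightarrow> A ** matrix_inv A = mat 1"
  and matrix_inv_left: "invertible A \<Longrightarrow> matrix_inv A ** A = mat 1"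
  for A :: "'a::semiring_1^'n^'n"
  unfolding invertible_def matrix_inv_def by (metis (mono_tags, lifting) someI_ex)+

lemma pos_def_mat_invertible: "pos_def_mat S \<Longrightarrow> invertible S"
  for S :: "real^'n^'n"
  unfolding pos_def_mat_def
  by (metis inner_zero_right less_irrefl invertible_left_inverse matrix_left_invertible_ker)

lemma norm_matrix_inv_diff_le:
  fixes S T :: "real^'n^'n"
  assumes S: "invertible S" and T: "invertible T"
    and a: "onorm ((*v) (matrix_inv S)) \<le> a" and d: "onorm ((*v) (T - S)) \<le> d"
    and ad: "a * d \<le> 1/2"
  shows "norm (matrix_inv S *v v - matrix_inv T *v v) \<le> 2 * a\<^sup>2 * d * norm v"
proof -
  define x where "x = matrix_inv T *v v"
  have a0: "0 \<le> a" using a onorm_matrix_nonneg order_trans by blast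
  have inv_S: "norm (matrix_inv S *v y) \<le> a * norm y" for y
    using norm_matrix_vector_mult_le a by (meson mult_right_mono norm_ge_zero order_trans)
  have diff: "norm ((T - S) *v y) \<le> d * norm y" for y
    using norm_matrix_vector_mult_le d by (meson mult_right_mono norm_ge_zero order_trans)
  have "T *v x = v"
    by (simp add: x_def matrix_vector_mul_assoc matrix_inv_right[OF T])
  moreover have "matrix_inv S *v (S *v x) = x"
    by (simp add: matrix_vector_mul_assoc matrix_inv_left[OF S])
  ultimately have resolvent: "matrix_inv S *v v - x = matrix_inv S *v ((T - S) *v x)"
    by (simp add: matrix_vector_mult_diff_rdistrib matrix_vector_mult_diff_distrib)
  have "norm x = norm (matrix_inv S *v v - matrix_inv S *v ((T - S) *v x))"
    by (simp add: resolvent[symmetric])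
  also have "\<dots> \<le> norm (matrix_inv S *v v) + norm (matrix_inv S *v ((T - S) *v x))"
    by (rule norm_triangle_ineq4)
  also have "\<dots> \<le> a * norm v + a * (d * norm x)"
    using inv_S diff a0 by (meson add_mono mult_left_mono order_trans)
  also have "a * (d * norm x) \<le> 1/2 * norm x"
    using mult_right_mono[OF ad norm_ge_zero] by (simp add: mult.assoc)
  finally have x_le: "norm x \<le> 2 * a * norm v" by simp
  have "norm (matrix_inv S *v v - x) \<le> a * (d * norm x)"
    unfolding resolvent using inv_S diff a0 by (meson mult_left_mono order_trans)
  also have "\<dots> \<le> a * (d * (2 * a * norm v))"
    using x_le a0 d onorm_matrix_nonneg[of "T - S"] by (intro mult_left_mono) auto
  finally show ?thesis unfolding x_def by (simp add: power2_eq_square algebra_simps)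
qed

lemma wnorm_matrix_inv_diff_le:
  fixes S T :: "real^'p^'p"
  assumes S: "invertible S" and T: "invertible T"
    and a: "onorm ((*v) (matrix_inv S)) \<le> a" and d: "onorm ((*v) (T - S)) \<le> d"
    and ad: "a * d \<le> 1/2"
  shows "\<bar>wnorm (matrix_inv S) v - wnorm (matrix_inv T) v\<bar> \<le> 2 * a * sqrt d * norm v"
proof -
  have a0: "0 \<le> a" and d0: "0 \<le> d"
    using a d onorm_matrix_nonneg order_trans by blast+
  have "\<bar>v \<bullet> (matrix_inv S *v v) / CARD('p) - v \<bullet> (matrix_inv T *v v) / CARD('p)\<bar>
      \<le> \<bar>v \<bullet> (matrix_inv S *v v - matrix_inv T *v v)\<bar>"
    by (simp add: inner_diff_right diff_divide_distrib[symmetric] divide_le_eq mult_le_cancel_left1)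
  also have "\<dots> \<le> norm v * (2 * a\<^sup>2 * d * norm v)"
    using Cauchy_Schwarz_ineq2 norm_matrix_inv_diff_le[OF assms]
    by (meson mult_left_mono norm_ge_zero order_trans)
  finally have "\<bar>wnorm (matrix_inv S) v - wnorm (matrix_inv T) v\<bar> \<le> sqrt (2 * (norm v * (2 * a\<^sup>2 * d * norm v)))"
    unfolding wnorm_def by (meson abs_sqrt_diff_le mult_left_mono order_trans real_sqrt_le_mono zero_le_numeral)
  also have "\<dots> = 2 * a * sqrt d * norm v"
    using a0 d0 by (simp add: real_sqrt_mult power2_eq_square algebra_simps)
  finally show ?thesis .
qed

section \<open>The detectors\<close>

lemma Max_image_diff_le:
  fixes f g :: "'a \<Rightarrow> real"
  assumes "finite J" "J \<noteq> {}" and close: "\<And>j. j \<in> J \<Longrightarrow> \<bar>f j - g j\<bar> \<le> b"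
  shows "\<bar>Max (f ` J) - Max (g ` J)\<bar> \<le> b"
proof -
  have Max_le: "Max (u ` J) \<le> Max (w ` J) + b" if "\<And>j. j \<in> J \<Longrightarrow> u j \<le> w j + b"
    for u w :: "'a \<Rightarrow> real"
  proof -
    have "Max (u ` J) \<in> u ` J" using assms(1,2) by simp
    then obtain j where "j \<in> J" "Max (u ` J) = u j" by blast
    moreover have "w j \<le> Max (w ` J)" using \<open>j \<in> J\<close> assms(1) by simp
    ultimately show ?thesis using that[of j] by linarith
  qed
  have "Max (f ` J) \<le> Max (g ` J) + b" "Max (g ` J) \<le> Max (f ` J) + b"
    using close unfolding abs_le_iff by (intro Max_le; force)+
  then show ?thesis by linarith
qed

lemma ybar_diff_eq_partial_sums:
  fixes y :: "nat \<Rightarrow> real^'p"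
  assumes "1 \<le> j" "j < k"
  shows "(real j * (real k - real j)) *\<^sub>R (ybar y 1 j - ybar y (j+1) k)
     = real k *\<^sub>R (\<Sum>l=1..j. y l - \<mu>) - real j *\<^sub>R (\<Sum>l=1..k. y l - \<mu>)"
proof -
  define P where "P i = (\<Sum>l=1..i. y l)" for i
  have split: "P k = P j + (\<Sum>l=j+1..k. y l)"
    unfolding P_def using sum.ub_add_nat[of 1 j y "k - j"] assms by simp
  have centred: "(\<Sum>l=1..i. y l - \<mu>) = P i - real i *\<^sub>R \<mu>" for i
    unfolding P_def by (simp add: sum_subtractf sum_constant_scaleR del: sum_constant)
  have "ybar y 1 j = (1 / real j) *\<^sub>R P j"
    and "ybar y (j+1) k = (1 / (real k - real j)) *\<^sub>R (P k - P j)"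
    unfolding ybar_def using split assms by (simp_all add: P_def)
  moreover have "real k - real j \<noteq> 0" "real j \<noteq> 0" using assms by auto
  ultimately have "(real j * (real k - real j)) *\<^sub>R (ybar y 1 j - ybar y (j+1) k)
      = (real k - real j) *\<^sub>R P j - real j *\<^sub>R (P k - P j)"
    by (simp add: scaleR_diff_right)
  then show ?thesis unfolding centred by (simp add: algebra_simps)
qed

lemma detector_diff_le:
  fixes y :: "nat \<Rightarrow> real^'p" and A B :: "real^'p^'p"
  assumes m: "1 \<le> m" "m < k" and \<beta>: "0 \<le> \<beta>"
    and partial_sums: "\<And>i. m \<le> i \<Longrightarrow> i \<le> k \<Longrightarrow> norm (\<Sum>l=1..i. y l - \<mu>) \<le> b"
    and wnorm_close: "\<And>v. \<bar>wnorm A v - wnorm B v\<bar> \<le> \<beta> * norm v"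
  shows "\<bar>detector A y m k - detector B y m k\<bar> \<le> 2 * \<beta> * real k * b / real m powr (3/2)"
  unfolding detector_def
proof (rule Max_image_diff_le)
  fix j assume j: "j \<in> {m..k-1}"
  define c where "c = real j * (real k - real j)"
  define v where "v = ybar y 1 j - ybar y (j+1) k"
  have c0: "0 \<le> c" using j m unfolding c_def by auto
  have "c *\<^sub>R v = real k *\<^sub>R (\<Sum>l=1..j. y l - \<mu>) - real j *\<^sub>R (\<Sum>l=1..k. y l - \<mu>)"
    unfolding c_def v_def using j m by (intro ybar_diff_eq_partial_sums) auto
  then have "norm (c *\<^sub>R v) \<le> real k * norm (\<Sum>l=1..j. y l - \<mu>) + real j * norm (\<Sum>l=1..k. y l - \<mu>)"
    using norm_triangle_ineq4 by (metis norm_scaleR abs_of_nat)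
  also have "\<dots> \<le> real k * b + real k * b"
  proof (intro add_mono mult_mono)
    have "m \<le> j" "j \<le> k" using j m by auto
    then show "norm (\<Sum>l=1..j. y l - \<mu>) \<le> b" "norm (\<Sum>l=1..k. y l - \<mu>) \<le> b"
      using partial_sums by (meson order_trans order_refl)+
  qed (use j in auto)
  finally have cv: "c * norm v \<le> 2 * real k * b" using c0 by (simp add: ac_simps)
  have "\<bar>c / real m powr (3/2) * wnorm A v - c / real m powr (3/2) * wnorm B v\<bar>
      = c / real m powr (3/2) * \<bar>wnorm A v - wnorm B v\<bar>"
    using c0 by (metis abs_mult abs_of_nonneg divide_nonneg_nonneg powr_ge_zero right_diff_distrib)
  also have "\<dots> \<le> c / real m powr (3/2) * (\<beta> * norm v)"
    using wnorm_close c0 by (intro mult_left_mono) auto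
  also have "\<dots> = \<beta> * (c * norm v) / real m powr (3/2)" by simp
  also have "\<dots> \<le> \<beta> * (2 * real k * b) / real m powr (3/2)"
    using cv \<beta> by (intro divide_right_mono mult_left_mono) auto
  also have "\<dots> = 2 * \<beta> * real k * b / real m powr (3/2)" by simp
  finally show "\<bar>real j * (real k - real j) / real m powr (3/2) * wnorm A (ybar y 1 j - ybar y (j+1) k)
      - real j * (real k - real j) / real m powr (3/2) * wnorm B (ybar y 1 j - ybar y (j+1) k)\<bar>
      \<le> 2 * \<beta> * real k * b / real m powr (3/2)"
    unfolding c_def v_def by simp
qed (use m in auto)

definition growth_sup :: "real \<Rightarrow> nat \<Rightarrow> (nat \<Rightarrow> 'v::real_normed_vector) \<Rightarrow> ereal" where
  "growth_sup \<eta> m x = (SUP n. ereal (real m powr \<eta> * norm (x n) / (real m + real n) powr (1/2 + \<eta>)))"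

lemma growth_sup_0 [simp]: "growth_sup \<eta> 0 x = 0"
  by (simp add: growth_sup_def)

lemma growth_sup_le_iff:
  assumes "1 \<le> m"
  shows "growth_sup \<eta> m x \<le> ereal K \<longleftrightarrow>
    (\<forall>n. norm (x n) \<le> K * real m powr (-\<eta>) * (real m + real n) powr (1/2 + \<eta>))"
proof -
  have "real m powr \<eta> * norm (x n) / (real m + real n) powr (1/2 + \<eta>) \<le> K \<longleftrightarrow>
      norm (x n) \<le> K * real m powr (-\<eta>) * (real m + real n) powr (1/2 + \<eta>)" for n
    using assms by (simp add: divide_le_eq powr_minus field_simps)
  then show ?thesis unfolding growth_sup_def by (simp add: SUP_le_iff)
qed

lemma borel_measurable_growth_sup [measurable]:
  fixes x :: "nat \<Rightarrow> 'a \<Rightarrow> 'v::euclidean_space"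
  assumes [measurable]: "\<And>n. x n \<in> borel_measurable M"
  shows "(\<lambda>\<omega>. growth_sup \<eta> m (\<lambda>n. x n \<omega>)) \<in> borel_measurable M"
  unfolding growth_sup_def by measurable

lemma detector_weight_cancel:
  fixes m k :: real
  assumes "0 < m" "0 < k"
  shows "(m / k) powr (3/2 + \<eta>) * (k * (m powr (-\<eta>) * k powr (1/2 + \<eta>)) / m powr (3/2)) = 1"
proof -
  have "k powr (3/2 + \<eta>) = k powr (1 + (1/2 + \<eta>))" by (simp add: algebra_simps)
  then have "k * k powr (1/2 + \<eta>) = k powr (3/2 + \<eta>)"
    using assms by (simp only: powr_add) simp
  moreover have "m powr (3/2 + \<eta>) * m powr (-\<eta>) = m powr (3/2)"
    using assms by (simp add: powr_add[symmetric])
  ultimately show ?thesis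
    using assms by (simp add: powr_divide field_simps) (smt (verit, best) mult.commute mult.left_commute)
qed

lemma weighted_detector_diff_le:
  fixes y :: "nat \<Rightarrow> real^'p" and A B :: "real^'p^'p"
  assumes m: "1 \<le> m" "m < k" and \<eta>: "0 < \<eta>" and \<beta>: "0 \<le> \<beta>" and K: "0 \<le> K"
    and growth: "growth_sup \<eta> m (\<lambda>n. \<Sum>l=1..m+n. y l - \<mu>) \<le> ereal K"
    and wnorm_close: "\<And>v. \<bar>wnorm A v - wnorm B v\<bar> \<le> \<beta> * norm v"
  shows "(real m / real k) powr (3/2 + \<eta>) * \<bar>detector A y m k - detector B y m k\<bar> \<le> 2 * K * \<beta>"
proof -
  define b where "b = K * real m powr (-\<eta>) * real k powr (1/2 + \<eta>)"
  have "norm (\<Sum>l=1..i. y l - \<mu>) \<le> b" if "m \<le> i" "i \<le> k" for i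
  proof -
    have "norm (\<Sum>l=1..m+(i-m). y l - \<mu>) \<le> K * real m powr (-\<eta>) * (real m + real (i-m)) powr (1/2 + \<eta>)"
      using growth unfolding growth_sup_le_iff[OF m(1)] by blast
    also have "\<dots> \<le> b"
      unfolding b_def using that \<eta> K by (intro mult_left_mono powr_mono2) auto
    finally show ?thesis using that by simp
  qed
  then have "\<bar>detector A y m k - detector B y m k\<bar> \<le> 2 * \<beta> * real k * b / real m powr (3/2)"
    using m \<beta> wnorm_close by (intro detector_diff_le) auto
  then have "(real m / real k) powr (3/2 + \<eta>) * \<bar>detector A y m k - detector B y m k\<bar>
      \<le> (real m / real k) powr (3/2 + \<eta>) * (2 * \<beta> * real k * b / real m powr (3/2))"
    by (rule mult_left_mono) simp
  also have "\<dots> = 2 * K * \<beta> * ((real m / real k) powr (3/2 + \<eta>)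
           * (real k * (real m powr (-\<eta>) * real k powr (1/2 + \<eta>)) / real m powr (3/2)))"
    unfolding b_def by (simp add: field_simps)
  also have "\<dots> = 2 * K * \<beta>" by (subst detector_weight_cancel) (use m in auto)
  finally show ?thesis .
qed

lemma detector_sup_diff_le:
  fixes \<Sigma> S :: "real^'p^'p" and y :: "nat \<Rightarrow> real^'p"
  assumes \<Sigma>: "invertible \<Sigma>" and S: "invertible S"
    and a: "onorm ((*v) (matrix_inv \<Sigma>)) \<le> a" "1 \<le> a"
    and close: "4 * a * real CARD('p) * sqrt (norm (S - \<Sigma>)) \<le> 1"
    and \<eta>: "0 < \<eta>" and K: "0 \<le> K" "growth_sup \<eta> m (\<lambda>n. \<Sum>l=1..m+n. y l - \<mu>) \<le> ereal K"
  shows "(SUP k\<in>{m<..}. ereal ((real m / real k) powr (3/2 + \<eta>) *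
      \<bar>detector (matrix_inv \<Sigma>) y m k - detector (matrix_inv S) y m k\<bar>))
    \<le> ereal K * ereal (4 * a * real CARD('p) * sqrt (norm (S - \<Sigma>)))"
proof (cases "m = 0")
  case True
  \<comment> \<open>all terms vanish, since \<open>0 powr _ = 0\<close>\<close>
  then show ?thesis using K a by (simp add: SUP_le_iff)
next
  case False
  then have m: "1 \<le> m" by simp
  define p where "p = real CARD('p)"
  define d where "d = p * p * norm (S - \<Sigma>)"
  define \<beta> where "\<beta> = 2 * a * sqrt d"
  have p: "1 \<le> p" unfolding p_def by simp
  have \<beta>: "0 \<le> \<beta>" "2 * K * \<beta> = K * (4 * a * p * sqrt (norm (S - \<Sigma>)))"
    using a p unfolding \<beta>_def d_def by (simp_all add: real_sqrt_mult)
  have "(4 * a * p * sqrt (norm (S - \<Sigma>)))\<^sup>2 \<le> 1"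
    using close a(2) unfolding p_def by (intro power_le_one) auto
  then have "16 * a * (a * d) \<le> 1"
    unfolding d_def by (simp add: power2_eq_square algebra_simps)
  moreover have "16 * (a * d) \<le> 16 * a * (a * d)"
    using a(2) p by (intro mult_right_mono) (auto simp: d_def)
  ultimately have ad: "a * d \<le> 1/2" by linarith
  have "onorm ((*v) (S - \<Sigma>)) \<le> d" unfolding d_def p_def by (rule onorm_matrix_le_norm)
  then have "\<bar>wnorm (matrix_inv \<Sigma>) v - wnorm (matrix_inv S) v\<bar> \<le> \<beta> * norm v" for v
    unfolding \<beta>_def by (rule wnorm_matrix_inv_diff_le[OF \<Sigma> S a(1) _ ad])
  then have "(real m / real k) powr (3/2 + \<eta>) *
      \<bar>detector (matrix_inv \<Sigma>) y m k - detector (matrix_inv S) y m k\<bar> \<le> 2 * K * \<beta>"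
    if "m < k" for k
    using m that \<eta> \<beta>(1) K by (intro weighted_detector_diff_le) auto
  then show ?thesis using \<beta>(2) unfolding p_def by (simp add: SUP_le_iff)
qed

section \<open>Boundedness in probability\<close>

lemma (in finite_measure) finite_measure_mono_Un:
  assumes "A \<subseteq> B \<union> C" "B \<in> sets M" "C \<in> sets M"
  shows "measure M A \<le> measure M B + measure M C"
proof -
  have "measure M A \<le> measure M (B \<union> C)" using assms by (intro finite_measure_mono) auto
  also have "\<dots> \<le> measure M B + measure M C" using assms(2,3) by (rule measure_Un_le)
  finally show ?thesis .
qed

lemma bdd_in_prob_max:
  assumes P: "prob_space M" and X: "bdd_in_prob M X" and Y: "bdd_in_prob M Y"
    and meas: "\<And>m. X m \<in> borel_measurable M" "\<And>m. Y m \<in> borel_measurable M"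
  shows "bdd_in_prob M (\<lambda>m \<omega>. max (X m \<omega>) (Y m \<omega>))"
  unfolding bdd_in_prob_def
proof (intro allI impI)
  interpret prob_space M by (rule P)
  note meas[measurable]
  fix \<epsilon> :: real assume "0 < \<epsilon>"
  then have "0 < \<epsilon>/2" by simp
  then obtain C N D N' where
    C: "\<And>m. N \<le> m \<Longrightarrow> measure M {\<omega>\<in>space M. X m \<omega> > ereal C} \<le> \<epsilon>/2" and
    D: "\<And>m. N' \<le> m \<Longrightarrow> measure M {\<omega>\<in>space M. Y m \<omega> > ereal D} \<le> \<epsilon>/2"
    using X Y unfolding bdd_in_prob_def by meson
  have "measure M {\<omega>\<in>space M. max (X m \<omega>) (Y m \<omega>) > ereal (max C D)} \<le> \<epsilon>"
    if "max N N' \<le> m" for m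
  proof -
    have "{\<omega>\<in>space M. max (X m \<omega>) (Y m \<omega>) > ereal (max C D)}
        \<subseteq> {\<omega>\<in>space M. X m \<omega> > ereal C} \<union> {\<omega>\<in>space M. Y m \<omega> > ereal D}"
    proof -
      have "ereal C \<le> ereal (max C D)" "ereal D \<le> ereal (max C D)" by simp_all
      then show ?thesis by (auto simp: less_max_iff_disj intro: order.strict_trans1)
    qed
    then have "measure M {\<omega>\<in>space M. max (X m \<omega>) (Y m \<omega>) > ereal (max C D)}
        \<le> measure M {\<omega>\<in>space M. X m \<omega> > ereal C} + measure M {\<omega>\<in>space M. Y m \<omega> > ereal D}"
      by (rule finite_measure_mono_Un) (measurable, measurable)
    also have "\<dots> \<le> \<epsilon>" using C[of m] D[of m] that by simp
    finally show ?thesis .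
  qed
  then show "\<exists>C N. \<forall>m\<ge>N. measure M {\<omega>\<in>space M. max (X m \<omega>) (Y m \<omega>) > ereal C} \<le> \<epsilon>"
    by blast
qed

lemma bdd_in_prob_if_bounded_on_sublevel_sets:
  assumes P: "prob_space M" and X: "bdd_in_prob M X" and meas: "\<And>m. X m \<in> borel_measurable M"
    and bound: "\<And>C. \<exists>K. \<forall>m. \<forall>\<omega>\<in>space M. X m \<omega> \<le> ereal C \<longrightarrow> F m \<omega> \<le> ereal K"
  shows "bdd_in_prob M F"
  unfolding bdd_in_prob_def
proof (intro allI impI)
  interpret prob_space M by (rule P)
  note meas[measurable]
  fix \<epsilon> :: real assume "0 < \<epsilon>"
  then obtain C N where C: "\<And>m. N \<le> m \<Longrightarrow> measure M {\<omega>\<in>space M. X m \<omega> > ereal C} \<le> \<epsilon>"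
    using X unfolding bdd_in_prob_def by blast
  obtain K where K: "\<And>m \<omega>. \<omega> \<in> space M \<Longrightarrow> X m \<omega> \<le> ereal C \<Longrightarrow> F m \<omega> \<le> ereal K"
    using bound by blast
  have "{\<omega>\<in>space M. F m \<omega> > ereal K} \<subseteq> {\<omega>\<in>space M. X m \<omega> > ereal C}" for m
    using K by (auto simp: not_le[symmetric])
  then have "measure M {\<omega>\<in>space M. F m \<omega> > ereal K} \<le> measure M {\<omega>\<in>space M. X m \<omega> > ereal C}" for m
    by (rule finite_measure_mono) measurable
  then show "\<exists>K N. \<forall>m\<ge>N. measure M {\<omega>\<in>space M. F m \<omega> > ereal K} \<le> \<epsilon>"
    using C order_trans by blast
qed

lemma small_in_prob_if_le_bdd_times_small:
  assumes P: "prob_space M" and X: "bdd_in_prob M X" and Z: "small_in_prob M Z"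
    and meas: "\<And>m. X m \<in> borel_measurable M" "\<And>m. Z m \<in> borel_measurable M"
    and bound: "\<And>m \<omega> C. \<omega> \<in> space M \<Longrightarrow> 0 \<le> C \<Longrightarrow> X m \<omega> \<le> ereal C \<Longrightarrow> Z m \<omega> \<le> 1
      \<Longrightarrow> F m \<omega> \<le> ereal C * Z m \<omega>"
  shows "small_in_prob M F"
  unfolding small_in_prob_def
proof (intro allI impI LIMSEQ_I)
  interpret prob_space M by (rule P)
  note meas[measurable]
  fix \<epsilon> \<delta> :: real assume "0 < \<epsilon>" "0 < \<delta>"
  then have "0 < \<delta>/2" by simp
  then obtain C0 N where C0: "\<And>m. N \<le> m \<Longrightarrow> measure M {\<omega>\<in>space M. X m \<omega> > ereal C0} \<le> \<delta>/2"
    using X unfolding bdd_in_prob_def by blast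
  define C where "C = max C0 0 + 1"
  define \<epsilon>' where "\<epsilon>' = min 1 (\<epsilon> / C)"
  have C: "0 < C" "C0 \<le> C" unfolding C_def by auto
  have \<epsilon>': "0 < \<epsilon>'" "\<epsilon>' \<le> 1" "C * \<epsilon>' \<le> \<epsilon>"
    using C \<open>0 < \<epsilon>\<close> unfolding \<epsilon>'_def by (auto simp: min_def field_simps)
  have "(\<lambda>m. measure M {\<omega>\<in>space M. Z m \<omega> > ereal \<epsilon>'}) \<longlonglongrightarrow> 0"
    using Z \<epsilon>'(1) unfolding small_in_prob_def by blast
  from LIMSEQ_D[OF this \<open>0 < \<delta>/2\<close>] obtain N' where
    N': "\<And>m. N' \<le> m \<Longrightarrow> measure M {\<omega>\<in>space M. Z m \<omega> > ereal \<epsilon>'} < \<delta>/2"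
    by auto
  have small: "F m \<omega> \<le> ereal \<epsilon>"
    if "\<omega> \<in> space M" "X m \<omega> \<le> ereal C" "Z m \<omega> \<le> ereal \<epsilon>'" for m \<omega>
  proof -
    have "ereal \<epsilon>' \<le> 1" using \<epsilon>'(2) by simp
    then have "Z m \<omega> \<le> 1" using that(3) by (rule order_trans[rotated])
    then have "F m \<omega> \<le> ereal C * Z m \<omega>" using that(1,2) C(1) by (intro bound) auto
    also have "\<dots> \<le> ereal C * ereal \<epsilon>'" by (rule ereal_mult_left_mono[OF that(3)]) (use C(1) in simp)
    also have "\<dots> \<le> ereal \<epsilon>" using \<epsilon>'(3) by simp
    finally show ?thesis .
  qed
  show "\<exists>N''. \<forall>m\<ge>N''. norm (measure M {\<omega>\<in>space M. F m \<omega> > ereal \<epsilon>} - 0) < \<delta>"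
  proof (intro exI allI impI)
    fix m assume m: "max N N' \<le> m"
    have "{\<omega>\<in>space M. F m \<omega> > ereal \<epsilon>}
        \<subseteq> {\<omega>\<in>space M. X m \<omega> > ereal C0} \<union> {\<omega>\<in>space M. Z m \<omega> > ereal \<epsilon>'}"
    proof
      fix \<omega> assume \<omega>: "\<omega> \<in> {\<omega>\<in>space M. F m \<omega> > ereal \<epsilon>}"
      have "\<not> (X m \<omega> \<le> ereal C \<and> Z m \<omega> \<le> ereal \<epsilon>')"
        using small[of \<omega> m] \<omega> by auto
      moreover have "ereal C0 \<le> ereal C" using C(2) by simp
      then have "ereal C < X m \<omega> \<Longrightarrow> ereal C0 < X m \<omega>" by (rule order.strict_trans1)
      ultimately show "\<omega> \<in> {\<omega>\<in>space M. X m \<omega> > ereal C0} \<union> {\<omega>\<in>space M. Z m \<omega> > ereal \<epsilon>'}"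
        using \<omega> by (auto simp: not_le)
    qed
    then have "measure M {\<omega>\<in>space M. F m \<omega> > ereal \<epsilon>}
        \<le> measure M {\<omega>\<in>space M. X m \<omega> > ereal C0} + measure M {\<omega>\<in>space M. Z m \<omega> > ereal \<epsilon>'}"
      by (rule finite_measure_mono_Un) (measurable, measurable)
    also have "\<dots> < \<delta>" using C0[of m] N'[of m] m by simp
    finally show "norm (measure M {\<omega>\<in>space M. F m \<omega> > ereal \<epsilon>} - 0) < \<delta>" by simp
  qed
qed

lemma small_in_prob_sqrt_dist:
  assumes S: "conv_in_prob_mat M S L" and \<kappa>: "0 \<le> \<kappa>"
  shows "small_in_prob M (\<lambda>m \<omega>. ereal (\<kappa> * sqrt (norm (S m \<omega> - L))))"
  unfolding small_in_prob_def
proof (intro allI impI)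
  fix \<epsilon> :: real assume \<epsilon>: "0 < \<epsilon>"
  show "(\<lambda>m. measure M {\<omega>\<in>space M. ereal (\<kappa> * sqrt (norm (S m \<omega> - L))) > ereal \<epsilon>}) \<longlonglongrightarrow> 0"
  proof (cases "\<kappa> = 0")
    case True then show ?thesis using \<epsilon> by simp
  next
    case False
    then have "\<epsilon> < \<kappa> * sqrt x \<longleftrightarrow> (\<epsilon> / \<kappa>)\<^sup>2 < x" if "0 \<le> x" for x
    proof -
      have "\<epsilon> < \<kappa> * sqrt x \<longleftrightarrow> \<epsilon> / \<kappa> < sqrt x"
        using False \<kappa> by (simp add: divide_less_eq mult.commute)
      also have "\<dots> \<longleftrightarrow> sqrt ((\<epsilon> / \<kappa>)\<^sup>2) < sqrt x" using False \<kappa> \<epsilon> by simp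
      finally show ?thesis by (simp only: real_sqrt_less_iff)
    qed
    then have "{\<omega>\<in>space M. ereal (\<kappa> * sqrt (norm (S m \<omega> - L))) > ereal \<epsilon>}
        = {\<omega>\<in>space M. norm (S m \<omega> - L) > (\<epsilon> / \<kappa>)\<^sup>2}" for m
      by auto
    moreover have "0 < (\<epsilon> / \<kappa>)\<^sup>2" using False \<epsilon> by simp
    ultimately show ?thesis using S unfolding conv_in_prob_mat_def by presburger
  qed
qed

section \<open>Growth of Brownian paths\<close>

lemma borel_measurable_vec_nth [measurable (raw)]:
  fixes f :: "'a \<Rightarrow> real^'n"
  shows "f \<in> borel_measurable M \<Longrightarrow> (\<lambda>x. f x $ i) \<in> borel_measurable M"
  using measurable_compose[OF _ borel_measurable_nth] .

lemma borel_measurable_matrix_vector_mult [measurable (raw)]: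
  fixes A :: "real^'n^'m"
  shows "f \<in> borel_measurable M \<Longrightarrow> (\<lambda>x. A *v f x) \<in> borel_measurable M"
  using measurable_compose[OF _ borel_measurable_continuous_onI[OF matrix_vector_mult_linear_continuous_on]] .

definition gaussian_moment :: "nat \<Rightarrow> real" where
  "gaussian_moment q = fact (2*q) / (2^q * fact q)"

lemma gaussian_moment_nonneg: "0 \<le> gaussian_moment q"
  by (simp add: gaussian_moment_def)

lemma normal_tail_le_moment:
  fixes Z :: "'a \<Rightarrow> real"
  assumes P: "prob_space M" and D: "distributed M lborel Z (normal_density 0 \<sigma>)"
    and \<sigma>: "0 < \<sigma>" and c: "0 < c"
  shows "measure M {\<omega>\<in>space M. c < \<bar>Z \<omega>\<bar>} \<le> gaussian_moment q * \<sigma>^(2*q) / c^(2*q)"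
proof -
  interpret prob_space M by (rule P)
  have [measurable]: "Z \<in> borel_measurable M"
    using distributed_measurable[OF D] by simp
  have moment: "has_bochner_integral lborel (\<lambda>x. normal_density 0 \<sigma> x * x ^ (2*q))
      (gaussian_moment q * \<sigma>^(2*q))"
    using normal_moment_even[OF \<sigma>, of 0 q]
    by (simp add: gaussian_moment_def power_divide power_mult)
  have int: "integrable M (\<lambda>\<omega>. Z \<omega> ^ (2*q))"
    using distributed_integrable[OF D, of "\<lambda>x. x ^ (2*q)"] integrable.intros[OF moment] by simp
  have E: "(\<integral>\<omega>. Z \<omega> ^ (2*q) \<partial>M) = gaussian_moment q * \<sigma>^(2*q)"
    using distributed_integral[OF D, of "\<lambda>x. x ^ (2*q)"] has_bochner_integral_integral_eq[OF moment]
    by simp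
  have "{\<omega>\<in>space M. c < \<bar>Z \<omega>\<bar>} \<subseteq> {\<omega>\<in>space M. c ^ (2*q) \<le> Z \<omega> ^ (2*q)}"
  proof safe
    fix \<omega> assume "c < \<bar>Z \<omega>\<bar>"
    then have "c ^ (2*q) \<le> \<bar>Z \<omega>\<bar> ^ (2*q)" using c by (intro power_mono) auto
    then show "c ^ (2*q) \<le> Z \<omega> ^ (2*q)" by (simp add: power_even_abs)
  qed
  then have "measure M {\<omega>\<in>space M. c < \<bar>Z \<omega>\<bar>} \<le> measure M {\<omega>\<in>space M. c ^ (2*q) \<le> Z \<omega> ^ (2*q)}"
    by (rule finite_measure_mono) measurable
  also have "\<dots> \<le> (\<integral>\<omega>. Z \<omega> ^ (2*q) \<partial>M) / c ^ (2*q)"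
    using c by (intro integral_Markov_inequality_measure[OF int]) (auto simp: power_mult)
  finally show ?thesis unfolding E .
qed

lemma std_BM_increment_tail:
  assumes P: "prob_space M" and W: "std_BM M W" and st: "0 \<le> s" "s < t" and c: "0 < c"
  shows "measure M {\<omega>\<in>space M. c < \<bar>W t \<omega> $ a - W s \<omega> $ a\<bar>}
    \<le> gaussian_moment q * (t - s)^q / c^(2*q)"
proof -
  have "distributed M lborel (\<lambda>\<omega>. (W t \<omega> - W s \<omega>) $ a) (normal_density 0 (sqrt (t - s)))"
    using W st unfolding std_BM_def by blast
  from normal_tail_le_moment[OF P this _ c, of q] show ?thesis
    using st by (simp add: power_mult)
qed

lemma dyadic_chain_bound:
  fixes X :: "nat \<Rightarrow> real"
  assumes "\<And>s i. s < L \<Longrightarrow> i < 2^(L-s) \<Longrightarrow> \<bar>X ((i+1)*2^s) - X (i*2^s)\<bar> \<le> t s"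
    and "n < 2^L"
  shows "\<bar>X n - X 0\<bar> \<le> (\<Sum>s<L. t s)"
  using assms
proof (induction L arbitrary: X n)
  case 0 then show ?case by simp
next
  case (Suc L)
  have top: "\<bar>X (2^L) - X 0\<bar> \<le> t L" using Suc.prems(1)[of L 0] by simp
  show ?case
  proof (cases "n < 2^L")
    case True
    have "\<bar>X n - X 0\<bar> \<le> (\<Sum>s<L. t s)"
    proof (rule Suc.IH)
      fix s i :: nat assume "s < L" "i < 2^(L-s)"
      then show "\<bar>X ((i+1)*2^s) - X (i*2^s)\<bar> \<le> t s"
        using Suc.prems(1)[of s i] by (simp add: Suc_diff_le)
    qed (rule True)
    then show ?thesis using top by simp
  next
    case False
    define Y where "Y k = X (2^L + k)" for k
    have shift: "Y ((i+1)*2^s) = X ((i + 2^(L-s) + 1)*2^s)" "Y (i*2^s) = X ((i + 2^(L-s))*2^s)"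
      if "s < L" for s i
      unfolding Y_def using that by (simp_all add: algebra_simps power_add[symmetric])
    have "\<bar>Y (n - 2^L) - Y 0\<bar> \<le> (\<Sum>s<L. t s)"
    proof (rule Suc.IH)
      fix s i :: nat assume s: "s < L" "i < 2^(L-s)"
      then have "i + 2^(L-s) < 2^(Suc L - s)" by (simp add: Suc_diff_le)
      then show "\<bar>Y ((i+1)*2^s) - Y (i*2^s)\<bar> \<le> t s"
        unfolding shift[OF s(1)] using Suc.prems(1) s by simp
    qed (use Suc.prems(2) in simp)
    then have "\<bar>X n - X (2^L)\<bar> \<le> (\<Sum>s<L. t s)" unfolding Y_def using False by simp
    then show ?thesis using top by simp
  qed
qed

lemma sum_power_diff_le:
  fixes x :: real
  assumes "0 \<le> x" "x < 1"
  shows "(\<Sum>s<L. x^(L-s)) \<le> x / (1 - x)"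
proof -
  have "(\<Sum>s<L. x^(L-s)) = (\<Sum>s<L. (\<lambda>i. x^(Suc i)) (L - Suc s))"
    by (intro sum.cong) (auto simp: Suc_diff_Suc)
  also have "\<dots> = (\<Sum>i<L. x^(Suc i))" by (rule sum.nat_diff_reindex)
  also have "\<dots> = x * ((1 - x^L) / (1 - x))"
    using assms by (simp add: sum_distrib_left[symmetric] sum_gp_strict)
  also have "\<dots> \<le> x * (1 / (1 - x))"
    using assms by (intro mult_left_mono divide_right_mono) auto
  finally show ?thesis by simp
qed

lemma abs_le_of_dyadic_block:
  fixes X :: "nat \<Rightarrow> real"
  assumes grid: "\<bar>X (n div 2^L * 2^L)\<bar> \<le> g"
    and chain: "\<And>s i. s < L \<Longrightarrow> i < 2^(L-s) \<Longrightarrow>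
      \<bar>X (n div 2^L * 2^L + (i+1)*2^s) - X (n div 2^L * 2^L + i*2^s)\<bar> \<le> g * (3/4)^(L-s)"
  shows "\<bar>X n\<bar> \<le> 4 * g"
proof -
  define b where "b = n div 2^L * 2^L"
  have "\<bar>X (b + n mod 2^L) - X (b + 0)\<bar> \<le> (\<Sum>s<L. g * (3/4)^(L-s))"
    by (rule dyadic_chain_bound[where X="\<lambda>k. X (b + k)"]) (use chain in \<open>auto simp: b_def\<close>)
  also have "\<dots> \<le> g * 3"
    unfolding sum_distrib_left[symmetric] using sum_power_diff_le[of "3/4" L] grid
    by (intro mult_left_mono) auto
  finally show ?thesis using grid unfolding b_def by (simp add: div_mult_mod_eq)
qed

lemma exists_power_of_two_between:
  assumes "1 \<le> (m::nat)"
  obtains L where "m \<le> 2^L" "2^L \<le> 2*m"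
proof -
  define L where "L = (LEAST L. m \<le> 2^L)"
  have "m \<le> 2^L" unfolding L_def by (rule LeastI_ex) (use less_exp less_imp_le in blast)
  moreover have "2^L \<le> 2*m"
  proof (cases L)
    case (Suc K)
    then have "\<not> m \<le> 2^K" unfolding L_def by (metis lessI not_less_Least)
    then show ?thesis using Suc by simp
  qed (use assms in simp)
  ultimately show ?thesis using that by blast
qed

lemma dyadic_block_threshold_le:
  assumes m: "1 \<le> m" "m \<le> 2^L" "2^L \<le> 2*m" and \<eta>: "0 < \<eta>"
  shows "(1 + real (n div 2^L)) powr (1/2 + \<eta>) * sqrt (2^L)
    \<le> sqrt 2 * (real m powr (-\<eta>) * (real m + real n) powr (1/2 + \<eta>))"
proof -
  define j where "j = n div 2^L"
  have "sqrt (2^L) \<le> sqrt 2 * sqrt (real m)"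
    using m(3) by (simp add: real_sqrt_mult[symmetric]) (metis of_nat_le_iff of_nat_mult of_nat_numeral of_nat_power)
  then have "(1 + real j) powr (1/2 + \<eta>) * sqrt (2^L) \<le> sqrt 2 * ((1 + real j) powr (1/2 + \<eta>) * sqrt (real m))"
    by (simp add: mult_left_mono)
  also have "(1 + real j) powr (1/2 + \<eta>) * sqrt (real m) = real m powr (-\<eta>) * (real m * (1 + real j)) powr (1/2 + \<eta>)"
    using m(1) by (simp add: powr_mult powr_add[symmetric] powr_half_sqrt[symmetric])
  also have "real m * (1 + real j) \<le> real m + real n"
  proof -
    have "j * m \<le> j * 2^L" using m(2) by simp
    also have "\<dots> \<le> n" unfolding j_def by simp
    finally show ?thesis by (simp add: algebra_simps) (metis of_nat_le_iff of_nat_mult)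
  qed
  then have "real m powr (-\<eta>) * (real m * (1 + real j)) powr (1/2 + \<eta>)
      \<le> real m powr (-\<eta>) * (real m + real n) powr (1/2 + \<eta>)"
    using \<eta> by (intro mult_left_mono powr_mono2) auto
  finally show ?thesis unfolding j_def by (simp add: mult_left_mono)
qed

(* The level-s thresholds decay like (3/4)^(L-s): slowly enough that they add up to at most three
   times the top threshold (abs_le_of_dyadic_block), fast enough that the 2^(L-s) increments of
   variance 2^s on level s, tested with 2q-th moments, contribute (2 (8/9)^q)^(L-s) <= 2^-(L-s). *)
lemma dyadic_level_ratio_le:
  fixes c :: real
  assumes s: "s \<le> L" and q: "12 \<le> q" and c: "0 < c"
  shows "2^(L-s) * ((2^s)^q / (c * sqrt (2^L) * (3/4)^(L-s))^(2*q)) \<le> (1/2)^(L-s) / c^(2*q)"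
proof -
  have L: "(2::real)^L = 2^s * 2^(L-s)" using s by (simp add: power_add[symmetric])
  have "sqrt ((2::real)^L) ^ (2*q) = (2^L)^q" by (simp add: power_mult)
  moreover have "((3/4::real)^(L-s))^(2*q) = ((9/16)^q)^(L-s)"
  proof -
    have "((3/4::real)^(L-s))^(2*q) = (((3/4)^2)^q)^(L-s)" by (simp only: power_mult[symmetric] ac_simps)
    then show ?thesis by (simp add: power2_eq_square)
  qed
  ultimately have e: "(c * sqrt (2^L) * (3/4)^(L-s))^(2*q) = c^(2*q) * (2^L)^q * ((9/16)^q)^(L-s)"
    by (simp only: power_mult_distrib)
  have r: "((2::real)^s)^q / (2^L)^q = ((1/2)^q)^(L-s)"
    unfolding L by (simp add: power_mult_distrib power_mult[symmetric] mult.commute power_divide)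
  have "(2^s)^q / (c * sqrt (2^L) * (3/4)^(L-s))^(2*q)
      = (((2::real)^s)^q / (2^L)^q) / ((9/16)^q)^(L-s) / c^(2*q)"
    unfolding e using c by (simp add: field_simps)
  also have "\<dots> = ((8/9)^q)^(L-s) / c^(2*q)"
    unfolding r
    by (simp add: power_divide[symmetric] power_mult_distrib[symmetric])
  finally have ratio: "(2^s)^q / (c * sqrt (2^L) * (3/4)^(L-s))^(2*q) = ((8/9)^q)^(L-s) / c^(2*q)" .
  have "(8/9::real)^q \<le> (8/9)^12" using q by (intro power_decreasing) auto
  also have "(8/9::real)^12 \<le> 1/4" by (simp add: power_divide)
  finally have "(8/9::real)^q \<le> 1/4" .
  then have "(2::real)^(L-s) * ((8/9)^q)^(L-s) \<le> 2^(L-s) * (1/4)^(L-s)"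
    by (intro mult_left_mono power_mono) auto
  also have "\<dots> = (1/2)^(L-s)" by (simp add: power_mult_distrib[symmetric])
  finally show ?thesis unfolding ratio using c by (simp add: divide_right_mono)
qed

lemma std_BM_dyadic_increments_tail:
  assumes P: "prob_space M" and W: "std_BM M W" and q: "12 \<le> q" and c: "0 < c"
  shows "measure M (\<Union>s<L. \<Union>i<2^(L-s). {\<omega>\<in>space M.
      c * sqrt (2^L) * (3/4)^(L-s) < \<bar>W (real (b + (i+1)*2^s)) \<omega> $ a - W (real (b + i*2^s)) \<omega> $ a\<bar>})
    \<le> gaussian_moment q / c^(2*q)"
proof -
  interpret prob_space M by (rule P)
  have [measurable]: "\<And>t. W t \<in> borel_measurable M" using W unfolding std_BM_def by auto
  define thr where "thr s = c * sqrt (2^L) * (3/4::real)^(L-s)" for s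
  define E where "E s i = {\<omega>\<in>space M.
      thr s < \<bar>W (real (b + (i+1)*2^s)) \<omega> $ a - W (real (b + i*2^s)) \<omega> $ a\<bar>}" for s i
  have E_sets: "E s i \<in> sets M" for s i unfolding E_def by measurable
  have E_tail: "measure M (E s i) \<le> gaussian_moment q * (2^s)^q / thr s ^ (2*q)" for s i
  proof -
    have "0 < thr s" unfolding thr_def using c by simp
    from std_BM_increment_tail[OF P W _ _ this, of "real (b + i*2^s)" "real (b + (i+1)*2^s)" a q]
    show ?thesis unfolding E_def by (simp add: algebra_simps)
  qed
  have "measure M (\<Union>s<L. \<Union>i<2^(L-s). E s i) \<le> (\<Sum>s<L. \<Sum>i<(2::nat)^(L-s). measure M (E s i))"
    by (intro order_trans[OF measure_UNION_le] sum_mono measure_UNION_le) (auto simp: E_sets)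
  also have "\<dots> \<le> (\<Sum>s<L. gaussian_moment q * (2^(L-s) * ((2^s)^q / thr s ^ (2*q))))"
    using E_tail by (intro sum_mono order_trans[OF sum_mono[OF E_tail]]) (simp add: algebra_simps)
  also have "\<dots> \<le> (\<Sum>s<L. gaussian_moment q * ((1/2)^(L-s) / c^(2*q)))"
    unfolding thr_def using q c
    by (intro sum_mono mult_left_mono gaussian_moment_nonneg dyadic_level_ratio_le) auto
  also have "\<dots> = gaussian_moment q / c^(2*q) * (\<Sum>s<L. (1/2)^(L-s))"
    by (simp add: sum_distrib_left)
  also have "\<dots> \<le> gaussian_moment q / c^(2*q) * 1"
    using sum_power_diff_le[of "1/2" L] by (intro mult_left_mono) (auto simp: gaussian_moment_nonneg)
  finally show ?thesis unfolding E_def thr_def by simp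
qed

lemma std_BM_grid_tail:
  assumes P: "prob_space M" and W: "std_BM M W" and c: "0 < c" and h: "0 < h" and \<eta>: "0 < \<eta>"
  shows "measure M {\<omega>\<in>space M. c * (1 + real j) powr (1/2 + \<eta>) * sqrt h < \<bar>W (real j * h) \<omega> $ a\<bar>}
    \<le> gaussian_moment q / c^(2*q) * (1 + real j) powr (-(2 * real q * \<eta>))"
proof (cases "j = 0")
  case True
  have "W 0 \<omega> = 0" if "\<omega> \<in> space M" for \<omega> using W that unfolding std_BM_def by blast
  moreover have "0 < c * sqrt h" using c h by simp
  ultimately have empty: "{\<omega>\<in>space M. c * (1 + real j) powr (1/2 + \<eta>) * sqrt h < \<bar>W (real j * h) \<omega> $ a\<bar>} = {}"
    using True by auto
  show ?thesis unfolding empty by (simp add: gaussian_moment_nonneg)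
next
  case False
  define u where "u = 1 + real j"
  have u: "1 \<le> u" "real j \<le> u" unfolding u_def by simp_all
  have thr: "0 < c * u powr (1/2 + \<eta>) * sqrt h" using c h u by simp
  have "W 0 \<omega> = 0" if "\<omega> \<in> space M" for \<omega> using W that unfolding std_BM_def by blast
  then have "measure M {\<omega>\<in>space M. c * u powr (1/2 + \<eta>) * sqrt h < \<bar>W (real j * h) \<omega> $ a\<bar>}
      = measure M {\<omega>\<in>space M. c * u powr (1/2 + \<eta>) * sqrt h < \<bar>W (real j * h) \<omega> $ a - W 0 \<omega> $ a\<bar>}"
    by (intro arg_cong[where f="measure M"]) auto
  also have "\<dots> \<le> gaussian_moment q * (real j * h)^q / (c * u powr (1/2 + \<eta>) * sqrt h)^(2*q)"
    using std_BM_increment_tail[OF P W _ _ thr, of 0 "real j * h" a q] False h by simp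
  also have "(c * u powr (1/2 + \<eta>) * sqrt h)^(2*q) = c^(2*q) * u powr (2 * real q * (1/2 + \<eta>)) * h^q"
  proof -
    have "(u powr (1/2 + \<eta>))^(2*q) = u powr (2 * real q * (1/2 + \<eta>))"
      using u by (simp add: powr_power mult.commute)
    moreover have "(sqrt h)^(2*q) = h^q" using h by (simp add: power_mult)
    ultimately show ?thesis by (simp add: power_mult_distrib)
  qed
  also have "gaussian_moment q * (real j * h)^q / (c^(2*q) * u powr (2 * real q * (1/2 + \<eta>)) * h^q)
      = gaussian_moment q / c^(2*q) * (real j ^ q / u powr (2 * real q * (1/2 + \<eta>)))"
    using h by (simp add: power_mult_distrib)
  also have "\<dots> \<le> gaussian_moment q / c^(2*q) * u powr (-(2 * real q * \<eta>))"
  proof (rule mult_left_mono)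
    have "real j ^ q \<le> u powr real q" using u by (simp add: powr_realpow power_mono)
    then have "real j ^ q / u powr (2 * real q * (1/2 + \<eta>)) \<le> u powr real q / u powr (2 * real q * (1/2 + \<eta>))"
      by (rule divide_right_mono) simp
    also have "\<dots> = u powr (-(2 * real q * \<eta>))"
      using u by (simp add: powr_diff[symmetric] algebra_simps)
    finally show "real j ^ q / u powr (2 * real q * (1/2 + \<eta>)) \<le> u powr (-(2 * real q * \<eta>))" .
  qed (simp add: gaussian_moment_nonneg)
  finally show ?thesis unfolding u_def .
qed

lemma summable_one_plus_powr: "1 < r \<Longrightarrow> summable (\<lambda>j. (1 + real j) powr (-r))"
proof -
  assume "1 < r"
  then have "summable (\<lambda>n. real n powr (-r))" by (simp add: summable_real_powr_iff)
  then have "summable (\<lambda>n. real (n + 1) powr (-r))" by (rule summable_ignore_initial_segment)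
  then show ?thesis by (simp add: add.commute)
qed

lemma growth_sup_le_of_dyadic_blocks:
  fixes x :: "nat \<Rightarrow> real"
  assumes m: "1 \<le> m" "m \<le> 2^L" "2^L \<le> 2*m" and \<eta>: "0 < \<eta>" and c: "0 \<le> c"
    and grid: "\<And>j. \<bar>x (j * 2^L)\<bar> \<le> c * (1 + real j) powr (1/2 + \<eta>) * sqrt (2^L)"
    and chain: "\<And>j s i. s < L \<Longrightarrow> i < 2^(L-s) \<Longrightarrow> \<bar>x (j * 2^L + (i+1)*2^s) - x (j * 2^L + i*2^s)\<bar>
      \<le> c * (1 + real j) powr (1/2 + \<eta>) * sqrt (2^L) * (3/4)^(L-s)"
  shows "growth_sup \<eta> m x \<le> ereal (4 * sqrt 2 * c)"
  unfolding growth_sup_le_iff[OF m(1)]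
proof
  fix n
  have "\<bar>x n\<bar> \<le> 4 * (c * (1 + real (n div 2^L)) powr (1/2 + \<eta>) * sqrt (2^L))"
    using grid chain by (intro abs_le_of_dyadic_block)
  also have "\<dots> \<le> 4 * (c * (sqrt 2 * (real m powr (-\<eta>) * (real m + real n) powr (1/2 + \<eta>))))"
    using mult_left_mono[OF dyadic_block_threshold_le[OF m \<eta>, of n] c] by (simp add: mult.assoc)
  finally show "norm (x n) \<le> 4 * sqrt 2 * c * real m powr (-\<eta>) * (real m + real n) powr (1/2 + \<eta>)"
    by (simp add: ac_simps)
qed

lemma one_div_block_threshold_power_le:
  assumes c: "0 < c"
  shows "1 / (c * (1 + real j) powr (1/2 + \<eta>))^(2*q) \<le> (1 + real j) powr (-(2 * real q * \<eta>)) / c^(2*q)"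
proof -
  have "(1 + real j) powr (2 * real q * \<eta>) \<le> (1 + real j) powr (real (2*q) * (1/2 + \<eta>))"
    by (intro powr_mono) (simp_all add: algebra_simps)
  also have "\<dots> = ((1 + real j) powr (1/2 + \<eta>))^(2*q)"
    by (rule powr_power[symmetric]) simp
  finally have "1 / ((1 + real j) powr (1/2 + \<eta>))^(2*q) \<le> (1 + real j) powr (-(2 * real q * \<eta>))"
    unfolding powr_minus_divide by (intro divide_left_mono) auto
  then have "1 / ((1 + real j) powr (1/2 + \<eta>))^(2*q) / c^(2*q) \<le> (1 + real j) powr (-(2 * real q * \<eta>)) / c^(2*q)"
    by (rule divide_right_mono) (use c in simp)
  then show ?thesis by (simp add: power_mult_distrib mult.commute)
qed

lemma (in finite_measure) measure_UN_le_suminf: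
  assumes "\<And>j. B j \<in> sets M" "\<And>j. measure M (B j) \<le> u j" "summable u"
  shows "measure M (\<Union>j. B j) \<le> (\<Sum>j. u j)"
proof -
  have "summable (\<lambda>j. measure M (B j))"
    by (rule summable_comparison_test'[OF assms(3), of 0]) (use assms(2) in auto)
  then have "measure M (\<Union>j. B j) \<le> (\<Sum>j. measure M (B j))"
    by (intro finite_measure_subadditive_countably) (auto simp: assms(1))
  also have "\<dots> \<le> (\<Sum>j. u j)"
    using assms(2) \<open>summable (\<lambda>j. measure M (B j))\<close> assms(3) by (rule suminf_le)
  finally show ?thesis .
qed

lemma std_BM_coordinate_growth_tail:
  assumes P: "prob_space M" and W: "std_BM M W" and m: "1 \<le> m" and \<eta>: "0 < \<eta>"
    and q: "12 \<le> q" "1 < 2 * real q * \<eta>" and c: "0 < c"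
  shows "measure M {\<omega>\<in>space M. ereal (4 * sqrt 2 * c) < growth_sup \<eta> m (\<lambda>n. W (real n) \<omega> $ a)}
    \<le> 2 * gaussian_moment q / c^(2*q) * (\<Sum>j. (1 + real j) powr (-(2 * real q * \<eta>)))"
proof -
  interpret prob_space M by (rule P)
  have [measurable]: "\<And>t. W t \<in> borel_measurable M" using W unfolding std_BM_def by auto
  obtain L where L: "m \<le> 2^L" "2^L \<le> 2*m" using exists_power_of_two_between[OF m] .
  define X where "X n \<omega> = W (real n) \<omega> $ a" for n \<omega>
  define g where "g j = c * (1 + real j) powr (1/2 + \<eta>) * sqrt (2^L)" for j
  define u where "u j = 2 * gaussian_moment q / c^(2*q) * (1 + real j) powr (-(2 * real q * \<eta>))" for j
  define grid where "grid j = {\<omega>\<in>space M. g j < \<bar>X (j * 2^L) \<omega>\<bar>}" for j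
  define chain where "chain j = (\<Union>s<L. \<Union>i<2^(L-s). {\<omega>\<in>space M.
      g j * (3/4)^(L-s) < \<bar>X (j * 2^L + (i+1)*2^s) \<omega> - X (j * 2^L + i*2^s) \<omega>\<bar>})" for j
  have sets: "grid j \<in> sets M" "chain j \<in> sets M" for j unfolding grid_def chain_def X_def by measurable
  have "measure M (grid j \<union> chain j) \<le> u j" for j
  proof -
    have "measure M (grid j) \<le> u j / 2"
      using std_BM_grid_tail[OF P W c _ \<eta>, of "2^L" j a q] unfolding grid_def g_def X_def u_def by simp
    moreover have "measure M (chain j) \<le> u j / 2"
    proof -
      have "0 < c * (1 + real j) powr (1/2 + \<eta>)" using c by simp
      from std_BM_dyadic_increments_tail[OF P W q(1) this, of L "j * 2^L" a]
      have "measure M (chain j) \<le> gaussian_moment q * (1 / (c * (1 + real j) powr (1/2 + \<eta>))^(2*q))"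
        unfolding chain_def g_def X_def by (simp add: algebra_simps)
      also have "\<dots> \<le> gaussian_moment q * ((1 + real j) powr (-(2 * real q * \<eta>)) / c^(2*q))"
        by (rule mult_left_mono[OF one_div_block_threshold_power_le[OF c] gaussian_moment_nonneg])
      also have "\<dots> = u j / 2" unfolding u_def by simp
      finally show ?thesis .
    qed
    ultimately show ?thesis using measure_Un_le[OF sets(1)[of j] sets(2)[of j]] by simp
  qed
  moreover have "summable u"
    unfolding u_def by (intro summable_mult summable_one_plus_powr q(2))
  ultimately have "measure M (\<Union>j. grid j \<union> chain j) \<le> (\<Sum>j. u j)"
    using sets by (intro measure_UN_le_suminf) auto
  moreover have "{\<omega>\<in>space M. ereal (4 * sqrt 2 * c) < growth_sup \<eta> m (\<lambda>n. X n \<omega>)} \<subseteq> (\<Union>j. grid j \<union> chain j)"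
  proof (rule subsetI, rule ccontr)
    fix \<omega> assume \<omega>: "\<omega> \<in> {\<omega>\<in>space M. ereal (4 * sqrt 2 * c) < growth_sup \<eta> m (\<lambda>n. X n \<omega>)}"
      and "\<omega> \<notin> (\<Union>j. grid j \<union> chain j)"
    then have "growth_sup \<eta> m (\<lambda>n. X n \<omega>) \<le> ereal (4 * sqrt 2 * c)"
      using c unfolding grid_def chain_def g_def
      by (intro growth_sup_le_of_dyadic_blocks[OF m L \<eta>]) (auto simp: not_less)
    with \<omega> show False by (simp add: not_le[symmetric])
  qed
  then have "measure M {\<omega>\<in>space M. ereal (4 * sqrt 2 * c) < growth_sup \<eta> m (\<lambda>n. X n \<omega>)}
      \<le> measure M (\<Union>j. grid j \<union> chain j)"
    using sets by (intro finite_measure_mono) auto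
  moreover have "(\<Sum>j. u j) = 2 * gaussian_moment q / c^(2*q) * (\<Sum>j. (1 + real j) powr (-(2 * real q * \<eta>)))"
    unfolding u_def by (rule suminf_mult[OF summable_one_plus_powr[OF q(2)]])
  ultimately show ?thesis unfolding X_def by linarith
qed

lemma growth_sup_le_of_coordinates:
  fixes x :: "nat \<Rightarrow> real^'p" and K :: real
  assumes m: "1 \<le> m" and coordinates: "\<And>a. growth_sup \<eta> m (\<lambda>n. x n $ a) \<le> ereal K"
  shows "growth_sup \<eta> m x \<le> ereal (CARD('p) * K)"
  unfolding growth_sup_le_iff[OF m]
proof
  fix n
  have "norm (x n) \<le> (\<Sum>a\<in>UNIV. \<bar>x n $ a\<bar>)" by (rule norm_le_l1_cart)
  also have "\<dots> \<le> (\<Sum>a\<in>(UNIV::'p set). K * real m powr (-\<eta>) * (real m + real n) powr (1/2 + \<eta>))"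
    using coordinates unfolding growth_sup_le_iff[OF m] by (intro sum_mono) simp
  finally show "norm (x n) \<le> real CARD('p) * K * real m powr (-\<eta>) * (real m + real n) powr (1/2 + \<eta>)"
    by (simp add: mult.assoc)
qed

lemma std_BM_growth_tail:
  fixes W :: "real \<Rightarrow> 'a \<Rightarrow> real^'p"
  assumes P: "prob_space M" and W: "std_BM M W" and m: "1 \<le> m" and \<eta>: "0 < \<eta>"
    and q: "12 \<le> q" "1 < 2 * real q * \<eta>" and c: "0 < c"
  shows "measure M {\<omega>\<in>space M. ereal (CARD('p) * (4 * sqrt 2 * c)) < growth_sup \<eta> m (\<lambda>n. W (real n) \<omega>)}
    \<le> CARD('p) * (2 * gaussian_moment q / c^(2*q) * (\<Sum>j. (1 + real j) powr (-(2 * real q * \<eta>))))"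
proof -
  interpret prob_space M by (rule P)
  have [measurable]: "\<And>t. W t \<in> borel_measurable M" using W unfolding std_BM_def by auto
  define A where "A a = {\<omega>\<in>space M. ereal (4 * sqrt 2 * c) < growth_sup \<eta> m (\<lambda>n. W (real n) \<omega> $ a)}" for a
  have "{\<omega>\<in>space M. ereal (CARD('p) * (4 * sqrt 2 * c)) < growth_sup \<eta> m (\<lambda>n. W (real n) \<omega>)}
      \<subseteq> (\<Union>a. A a)"
    using growth_sup_le_of_coordinates[OF m] unfolding A_def by (force simp: not_less)
  then have "measure M {\<omega>\<in>space M. ereal (CARD('p) * (4 * sqrt 2 * c)) < growth_sup \<eta> m (\<lambda>n. W (real n) \<omega>)}
      \<le> measure M (\<Union>a. A a)"
    by (rule finite_measure_mono) (unfold A_def; measurable)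
  also have "\<dots> \<le> (\<Sum>a\<in>UNIV. measure M (A a))"
    by (rule measure_UNION_le) (auto simp: A_def)
  also have "\<dots> \<le> (\<Sum>a\<in>(UNIV::'p set). 2 * gaussian_moment q / c^(2*q) * (\<Sum>j. (1 + real j) powr (-(2 * real q * \<eta>))))"
    unfolding A_def by (intro sum_mono std_BM_coordinate_growth_tail[OF P W m \<eta> q c])
  finally show ?thesis by simp
qed

lemma bdd_in_prob_growth_sup_std_BM:
  fixes W :: "nat \<Rightarrow> real \<Rightarrow> 'a \<Rightarrow> real^'p"
  assumes P: "prob_space M" and W: "\<And>m. std_BM M (W m)" and \<eta>: "0 < \<eta>"
  shows "bdd_in_prob M (\<lambda>m \<omega>. growth_sup \<eta> m (\<lambda>n. W m (real n) \<omega>))"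
  unfolding bdd_in_prob_def
proof (intro allI impI)
  fix \<delta> :: real assume \<delta>: "0 < \<delta>"
  define q where "q = max 12 (nat \<lceil>1/\<eta>\<rceil>)"
  have "1/\<eta> \<le> real q" unfolding q_def by linarith
  then have q: "12 \<le> q" "1 < 2 * real q * \<eta>" using \<eta> by (auto simp: q_def field_simps)
  define Z where "Z = CARD('p) * (2 * gaussian_moment q * (\<Sum>j. (1 + real j) powr (-(2 * real q * \<eta>))))"
  have "0 \<le> Z"
    unfolding Z_def using summable_one_plus_powr[OF q(2)] gaussian_moment_nonneg[of q]
    by (intro mult_nonneg_nonneg suminf_nonneg) auto
  define c where "c = max 1 (Z / \<delta>)"
  have c: "1 \<le> c" "Z / c^(2*q) \<le> \<delta>"
  proof -
    show "1 \<le> c" unfolding c_def by simp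
    then have "Z / \<delta> \<le> c^(2*q)"
      using power_increasing[of 1 "2*q" c] q(1) unfolding c_def by auto
    then show "Z / c^(2*q) \<le> \<delta>"
      using \<delta> \<open>1 \<le> c\<close> by (simp add: field_simps)
  qed
  have "measure M {\<omega>\<in>space M. growth_sup \<eta> m (\<lambda>n. W m (real n) \<omega>) > ereal (CARD('p) * (4 * sqrt 2 * c))}
      \<le> \<delta>" for m
  proof (cases "m = 0")
    case True
    have "\<not> c * (real CARD('p) * sqrt 2) < 0" using c by (simp add: not_less)
    with True \<delta> show ?thesis by simp
  next
    case False
    then have "measure M {\<omega>\<in>space M. growth_sup \<eta> m (\<lambda>n. W m (real n) \<omega>) > ereal (CARD('p) * (4 * sqrt 2 * c))}
        \<le> Z / c^(2*q)"
      using std_BM_growth_tail[OF P W _ \<eta> q, of m c] c unfolding Z_def by (simp add: field_simps)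
    with c show ?thesis by linarith
  qed
  then show "\<exists>C N. \<forall>m\<ge>N. measure M {\<omega>\<in>space M. growth_sup \<eta> m (\<lambda>n. W m (real n) \<omega>) > ereal C} \<le> \<delta>"
    by blast
qed

section \<open>Growth of the partial sums\<close>

lemma powr_le_growth_weight:
  fixes t s :: real
  assumes m: "1 \<le> m" "m \<le> s" and t: "0 \<le> t" "t \<le> s" and \<xi>: "0 < \<xi>" "\<xi> < 1/2" and \<eta>: "0 < \<eta>"
  shows "t powr \<xi> \<le> m powr (-\<eta>) * s powr (1/2 + \<eta>)"
proof -
  have "t powr \<xi> \<le> s powr \<xi>" using t \<xi> by (intro powr_mono2) auto
  also have "\<dots> \<le> s powr (1/2)" using m \<xi> by (intro powr_mono) auto
  also have "\<dots> = s powr (-\<eta>) * s powr (1/2 + \<eta>)" using m by (simp add: powr_add[symmetric])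
  also have "\<dots> \<le> m powr (-\<eta>) * s powr (1/2 + \<eta>)"
    using m \<eta> by (intro mult_right_mono powr_mono2') auto
  finally show ?thesis .
qed

lemma norm_le_of_approximation:
  fixes R :: "real^'n^'k" and m s t :: real
  assumes m: "1 \<le> m" "m \<le> s" and t: "0 \<le> t" "t \<le> s" and \<xi>: "0 < \<xi>" "\<xi> < 1/2" and \<eta>: "0 < \<eta>"
    and C: "0 \<le> C"
    and signal: "norm u \<le> C * (m powr (-\<eta>) * s powr (1/2 + \<eta>))"
    and noise: "norm (x - R *v u) \<le> C * t powr \<xi>"
  shows "norm x \<le> (onorm ((*v) R) + 1) * C * (m powr (-\<eta>) * s powr (1/2 + \<eta>))"
proof -
  have "norm x \<le> norm (R *v u) + norm (x - R *v u)" by (rule norm_triangle_sub)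
  also have "norm (R *v u) \<le> onorm ((*v) R) * (C * (m powr (-\<eta>) * s powr (1/2 + \<eta>)))"
    using norm_matrix_vector_mult_le[of R u] signal onorm_matrix_nonneg[of R]
    by (meson mult_left_mono order_trans)
  also have "norm (x - R *v u) \<le> C * (m powr (-\<eta>) * s powr (1/2 + \<eta>))"
    using noise powr_le_growth_weight[OF m t \<xi> \<eta>] C by (meson mult_left_mono order_trans)
  finally show ?thesis by (simp add: algebra_simps)
qed

lemma partial_sum_growth_le:
  fixes y v w :: "nat \<Rightarrow> real^'p" and R :: "real^'p^'p"
  assumes \<xi>: "0 < \<xi>" "\<xi> < 1/2" and \<eta>: "0 < \<eta>" and C: "0 \<le> C"
    and tail: "(SUP k\<in>{m<..}. ereal (norm ((\<Sum>i=m+1..k. y i - \<mu>) - R *v v (k - m)) / real (k - m) powr \<xi>))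
      \<le> ereal C"
    and head: "ereal (norm ((\<Sum>i=1..m. y i - \<mu>) - R *v w m) / real m powr \<xi>) \<le> ereal C"
    and v_growth: "growth_sup \<eta> m v \<le> ereal C" and w_growth: "growth_sup \<eta> m w \<le> ereal C"
  shows "growth_sup \<eta> m (\<lambda>n. \<Sum>l=1..m+n. y l - \<mu>)
    \<le> ereal ((onorm ((*v) R) + 1) * (2 powr (1/2 + \<eta>) + 1) * C)"
proof (cases "m = 0")
  case True
  then show ?thesis using C onorm_matrix_nonneg[of R] by simp
next
  case False
  then have m: "1 \<le> m" by simp
  define Q where "Q n = real m powr (-\<eta>) * (real m + real n) powr (1/2 + \<eta>)" for n
  have path_le: "norm (x n) \<le> C * Q n" if "growth_sup \<eta> m x \<le> ereal C" for x :: "nat \<Rightarrow> real^'p" and n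
    using that unfolding growth_sup_le_iff[OF m] Q_def by (simp add: mult.assoc)
  have head_le: "norm (\<Sum>i=1..m. y i - \<mu>) \<le> (onorm ((*v) R) + 1) * C * Q m"
    unfolding Q_def using m head path_le[OF w_growth, of m]
    by (intro norm_le_of_approximation[OF _ _ _ _ \<xi> \<eta> C]) (auto simp: Q_def divide_le_eq mult.commute)
  have tail_le: "norm (\<Sum>i=m+1..m+n. y i - \<mu>) \<le> (onorm ((*v) R) + 1) * C * Q n" for n
  proof (cases "n = 0")
    case True then show ?thesis using C onorm_matrix_nonneg[of R] unfolding Q_def by simp
  next
    case False
    have "m + n \<in> {m<..}" using False by simp
    from SUP_le_iff[THEN iffD1, OF tail, rule_format, OF this]
    have "norm ((\<Sum>i=m+1..m+n. y i - \<mu>) - R *v v n) \<le> C * real n powr \<xi>"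
      using False by (simp add: divide_le_eq mult.commute)
    then show ?thesis
      unfolding Q_def using m path_le[OF v_growth, of n]
      by (intro norm_le_of_approximation[OF _ _ _ _ \<xi> \<eta> C]) (auto simp: Q_def)
  qed
  have "norm (\<Sum>l=1..m+n. y l - \<mu>) \<le> (onorm ((*v) R) + 1) * (2 powr (1/2 + \<eta>) + 1) * C * Q n" for n
  proof -
    have "Q m = 2 powr (1/2 + \<eta>) * (real m powr (-\<eta>) * real m powr (1/2 + \<eta>))"
      unfolding Q_def using m by (simp add: powr_mult[symmetric] mult_2[symmetric])
    also have "\<dots> \<le> 2 powr (1/2 + \<eta>) * Q n"
      unfolding Q_def using \<eta> by (intro mult_left_mono powr_mono2) auto
    finally have "Q m \<le> 2 powr (1/2 + \<eta>) * Q n" .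
    then have head_le': "norm (\<Sum>i=1..m. y i - \<mu>) \<le> (onorm ((*v) R) + 1) * C * (2 powr (1/2 + \<eta>) * Q n)"
      using head_le C onorm_matrix_nonneg[of R] by (meson mult_left_mono order_trans zero_le_mult_iff
          add_nonneg_nonneg zero_le_one)
    have "(\<Sum>l=1..m+n. y l - \<mu>) = (\<Sum>l=1..m. y l - \<mu>) + (\<Sum>l=m+1..m+n. y l - \<mu>)"
      by (rule sum.ub_add_nat) (use m in simp)
    then have "norm (\<Sum>l=1..m+n. y l - \<mu>) \<le> norm (\<Sum>l=1..m. y l - \<mu>) + norm (\<Sum>l=m+1..m+n. y l - \<mu>)"
      by (simp add: norm_triangle_ineq)
    also have "\<dots> \<le> (onorm ((*v) R) + 1) * C * (2 powr (1/2 + \<eta>) * Q n) + (onorm ((*v) R) + 1) * C * Q n"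
      by (intro add_mono head_le' tail_le)
    finally show ?thesis by (simp add: algebra_simps)
  qed
  then show ?thesis unfolding growth_sup_le_iff[OF m] Q_def by (simp add: mult.assoc)
qed

lemma bdd_in_prob_partial_sum_growth:
  fixes Y :: "nat \<Rightarrow> 'a \<Rightarrow> real^'p" and W1 W2 :: "nat \<Rightarrow> real \<Rightarrow> 'a \<Rightarrow> real^'p"
  assumes P: "prob_space M" and Y: "\<And>i. Y i \<in> borel_measurable M"
    and W1: "\<And>m. std_BM M (W1 m)" and W2: "\<And>m. std_BM M (W2 m)"
    and \<xi>: "0 < \<xi>" "\<xi> < 1/2" and \<eta>: "0 < \<eta>"
    and approx1: "bdd_in_prob M (\<lambda>m \<omega>. SUP k\<in>{m<..}. ereal
        (norm ((\<Sum>i=m+1..k. Y i \<omega> - \<mu>) - R *v W1 m (real (k - m)) \<omega>) / real (k - m) powr \<xi>))"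
    and approx2: "bdd_in_prob M (\<lambda>m \<omega>. ereal
        (norm ((\<Sum>i=1..m. Y i \<omega> - \<mu>) - R *v W2 m (real m) \<omega>) / real m powr \<xi>))"
  shows "bdd_in_prob M (\<lambda>m \<omega>. growth_sup \<eta> m (\<lambda>n. \<Sum>l=1..m+n. Y l \<omega> - \<mu>))"
proof -
  note Y[measurable]
  have [measurable]: "\<And>m t. W1 m t \<in> borel_measurable M" "\<And>m t. W2 m t \<in> borel_measurable M"
    using W1 W2 unfolding std_BM_def by auto
  define H where "H m \<omega> = max
      (max (SUP k\<in>{m<..}. ereal (norm ((\<Sum>i=m+1..k. Y i \<omega> - \<mu>) - R *v W1 m (real (k - m)) \<omega>)
              / real (k - m) powr \<xi>))
           (ereal (norm ((\<Sum>i=1..m. Y i \<omega> - \<mu>) - R *v W2 m (real m) \<omega>) / real m powr \<xi>)))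
      (max (growth_sup \<eta> m (\<lambda>n. W1 m (real n) \<omega>)) (growth_sup \<eta> m (\<lambda>n. W2 m (real n) \<omega>)))" for m \<omega>
  have "bdd_in_prob M H"
    unfolding H_def
    by (intro bdd_in_prob_max[OF P] approx1 approx2 bdd_in_prob_growth_sup_std_BM[OF P W1 \<eta>]
        bdd_in_prob_growth_sup_std_BM[OF P W2 \<eta>]) measurable
  moreover have "H m \<in> borel_measurable M" for m unfolding H_def by measurable
  ultimately show ?thesis
  proof (rule bdd_in_prob_if_bounded_on_sublevel_sets[OF P])
    fix C
    let ?K = "(onorm ((*v) R) + 1) * (2 powr (1/2 + \<eta>) + 1) * max C 0"
    have "growth_sup \<eta> m (\<lambda>n. \<Sum>l=1..m+n. Y l \<omega> - \<mu>) \<le> ereal ?K" if "H m \<omega> \<le> ereal C" for m \<omega>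
    proof (rule partial_sum_growth_le[OF \<xi> \<eta>, where v="\<lambda>n. W1 m (real n) \<omega>" and w="\<lambda>n. W2 m (real n) \<omega>"])
      have "ereal C \<le> ereal (max C 0)" by simp
      with that show "(SUP k\<in>{m<..}. ereal (norm ((\<Sum>i=m+1..k. Y i \<omega> - \<mu>) - R *v W1 m (real (k - m)) \<omega>)
              / real (k - m) powr \<xi>)) \<le> ereal (max C 0)"
        and "ereal (norm ((\<Sum>i=1..m. Y i \<omega> - \<mu>) - R *v W2 m (real m) \<omega>) / real m powr \<xi>) \<le> ereal (max C 0)"
        and "growth_sup \<eta> m (\<lambda>n. W1 m (real n) \<omega>) \<le> ereal (max C 0)"
        and "growth_sup \<eta> m (\<lambda>n. W2 m (real n) \<omega>) \<le> ereal (max C 0)"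
        unfolding H_def by (meson max.boundedE order_trans)+
    qed simp
    then show "\<exists>K. \<forall>m. \<forall>\<omega>\<in>space M. H m \<omega> \<le> ereal C \<longrightarrow>
        growth_sup \<eta> m (\<lambda>n. \<Sum>l=1..m+n. Y l \<omega> - \<mu>) \<le> ereal K"
      by blast
  qed
qed

theorem lemmaA4:
  fixes M :: "'a measure"
    and Y :: "nat \<Rightarrow> 'a \<Rightarrow> real^'p"
    and W1 W2 :: "nat \<Rightarrow> real \<Rightarrow> 'a \<Rightarrow> real^'p"
    and \<Sigma> :: "real^'p^'p"
    and Sm :: "nat \<Rightarrow> 'a \<Rightarrow> real^'p^'p"
    and \<xi> \<eta> :: real
  assumes P: "prob_space M"
    and Y_meas: "\<And>i. Y i \<in> borel_measurable M"
    and Y_L2: "\<And>i a. integrable M (\<lambda>\<omega>. (Y i \<omega> $ a)\<^sup>2)"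
    and stat: "strictly_stationary M Y"
    and BM: "\<And>m. std_BM M (W1 m)" "\<And>m. std_BM M (W2 m)"
    and BM_indep: "\<And>m. prob_space.indep_var M
        (PiM UNIV (\<lambda>_::real. borel)) (\<lambda>\<omega> t. W1 m t \<omega>)
        (PiM UNIV (\<lambda>_::real. borel)) (\<lambda>\<omega> t. W2 m t \<omega>)"
    and lr_summable: "summable (\<lambda>i. cov_mat M (Y 1) (Y (i+2)) + cov_mat M (Y (i+2)) (Y 1))"
    and \<Sigma>_def: "\<Sigma> = cov_mat M (Y 1) (Y 1)
        + (\<Sum>i. cov_mat M (Y 1) (Y (i+2)) + cov_mat M (Y (i+2)) (Y 1))"
    and \<Sigma>_pd: "pos_def_mat \<Sigma>"
    and \<xi>: "0 < \<xi>" "\<xi> < 1/2"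
    and approx1: "bdd_in_prob M (\<lambda>m \<omega>. SUP k\<in>{m<..}. ereal
        (norm ((\<Sum>i=m+1..k. Y i \<omega> - vexp M (Y 1))
               - mat_sqrt \<Sigma> *v W1 m (real (k - m)) \<omega>) / real (k - m) powr \<xi>))"
    and approx2: "bdd_in_prob M (\<lambda>m \<omega>. ereal
        (norm ((\<Sum>i=1..m. Y i \<omega> - vexp M (Y 1))
               - mat_sqrt \<Sigma> *v W2 m (real m) \<omega>) / real m powr \<xi>))"
    and Sm_meas: "\<And>m. Sm m \<in> borel_measurable M"
    and Sm_inv: "\<And>m \<omega>. \<omega> \<in> space M \<Longrightarrow> invertible (Sm m \<omega>)"
    and Sm_conv: "conv_in_prob_mat M Sm \<Sigma>"
    and \<eta>: "\<eta> > 0"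
  shows "small_in_prob M (\<lambda>m \<omega>. SUP k\<in>{m<..}. ereal
     ((real m / real k) powr (3/2 + \<eta>) *
      \<bar>detector (matrix_inv \<Sigma>) (\<lambda>i. Y i \<omega>) m k
       - detector (matrix_inv (Sm m \<omega>)) (\<lambda>i. Y i \<omega>) m k\<bar>))"
proof -
  interpret prob_space M by (rule P)
  note [measurable] = Y_meas Sm_meas
  define a where "a = onorm ((*v) (matrix_inv \<Sigma>)) + 1"
  define \<kappa> where "\<kappa> = 4 * a * real CARD('p)"
  define \<mu> where "\<mu> = vexp M (Y 1)"
  have a: "onorm ((*v) (matrix_inv \<Sigma>)) \<le> a" "1 \<le> a"
    unfolding a_def using onorm_matrix_nonneg[of "matrix_inv \<Sigma>"] by auto
  have growth: "bdd_in_prob M (\<lambda>m \<omega>. growth_sup \<eta> m (\<lambda>n. \<Sum>l=1..m+n. Y l \<omega> - \<mu>))"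
    unfolding \<mu>_def by (rule bdd_in_prob_partial_sum_growth[OF P Y_meas BM \<xi> \<eta> approx1 approx2])
  have close: "small_in_prob M (\<lambda>m \<omega>. ereal (\<kappa> * sqrt (norm (Sm m \<omega> - \<Sigma>))))"
    using a by (intro small_in_prob_sqrt_dist[OF Sm_conv]) (simp add: \<kappa>_def)
  show ?thesis
  proof (rule small_in_prob_if_le_bdd_times_small[OF P growth close])
    fix m \<omega> C
    assume "\<omega> \<in> space M" "0 \<le> C" "growth_sup \<eta> m (\<lambda>n. \<Sum>l=1..m+n. Y l \<omega> - \<mu>) \<le> ereal C"
      "ereal (\<kappa> * sqrt (norm (Sm m \<omega> - \<Sigma>))) \<le> 1"
    then show "(SUP k\<in>{m<..}. ereal ((real m / real k) powr (3/2 + \<eta>) *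
        \<bar>detector (matrix_inv \<Sigma>) (\<lambda>i. Y i \<omega>) m k - detector (matrix_inv (Sm m \<omega>)) (\<lambda>i. Y i \<omega>) m k\<bar>))
      \<le> ereal C * ereal (\<kappa> * sqrt (norm (Sm m \<omega> - \<Sigma>)))"
      unfolding \<kappa>_def
      using \<eta> by (intro detector_sup_diff_le[OF pos_def_mat_invertible[OF \<Sigma>_pd] Sm_inv a]) auto
  qed measurable
qed

end
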